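(* Let $G=(V_G,E_G)$ be a nonhomogeneous finite connected multigraph without self-loops, let $H=(V_H,E_H)$ be a homogeneous core of $G$, let $G/H$ be the corresponding shrunk graph, and let $\Gamma_G,\Gamma_H,\Gamma_{G/H}$ be the families of spanning trees of $G$, $H$, $G/H$. Let $\Gamma^*=\{\gamma\in\Gamma_G:\gamma\cap E_H\in\Gamma_H\}$ and let $\varphi:E_G\setminus E_H\to E_{G/H}$ be the natural edge bijection. Then: 1. $\mathrm{MEO}(\Gamma_G)=\mathrm{MEO}(\Gamma_H)+\mathrm{MEO}(\Gamma_{G/H})$; 2. a pmf $\mu\in\mathcal{P}(\Gamma_G)$ is optimal for $\mathrm{MEO}(\Gamma_G)$ if and only if $\mu\in\mathcal{P}(\Gamma^* )$ (i.e. $\mu$ is supported on $\Gamma^*$) and its marginal pmfs $\mu_H$ and $\mu_{G/H}$ are optimal for $\mathrm{MEO}(\Gamma_H)$ and $\mathrm{MEO}(\Gamma_{G/H})$ respectively; 3. conversely, given $\mu_H\in\mathcal{P}(\Gamma_H)$ and $\mu_{G/H}\in\mathcal{P}(\Gamma_{G/H})$ that are optimal for their respective MEO problems, $\mu_H\oplus(\varphi^{-1}_*\mu_{G/H})$ is an optimal pmf in $\mathcal{P}(\Gamma_G)$ for $\mathrm{MEO}(\Gamma_G)$; 4. for any pmf $\mu\in\mathcal{P}(\Gamma^* )$ with marginals $\mu_H$ and $\mu_{G/H}$, $\mathbb{P}_\mu(e\in\underline{\gamma})=\mathbb{P}_{\mu_H}(e\in\underline{\gamma}_H)$ if $e\in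 E_H$, and $\mathbb{P}_\mu(e\in\underline{\gamma})=\mathbb{P}_{\mu_{G/H}}(\varphi(e)\in\underline{\gamma}_{G/H})$ if $e\in E_G\setminus E_H$.
   Context: For a finite connected multigraph $G$, $\Gamma_G$ is the set of spanning trees (as edge subsets); $\mathcal{P}(\Gamma)$ is the set of probability mass functions (pmfs) on a finite set $\Gamma$; $\mathrm{MEO}(\Gamma)=\min_{\mu\in\mathcal{P}(\Gamma)}\sum_{\gamma,\gamma'\in\Gamma}|\gamma\cap\gamma'|\,\mu(\gamma)\mu(\gamma')$, and minimizers are called optimal. $\mathbb{P}_\mu(e\in\underline{\gamma})=\sum_{\gamma\ni e}\mu(\gamma)$. The values $\eta^*(e)=\mathbb{P}_{\mu^*}(e\in\underline\gamma)$ are the same for all optimal $\mu^*\in\mathcal{P}(\Gamma_G)$; $G$ is homogeneous if $\eta^*$ is constant, and nonhomogeneous otherwise. A spanning tree is fair if it has positive mass under some optimal pmf. A homogeneous core of $G$ is a connected subgraph $H$ which (1) has at least one edge, (2) satisfies $\gamma\cap E_H\in\Gamma_H$ for every fair tree $\gamma$ of $G$, (3) is vertex-induced (contains every edge of $G$ with both endpoints in $V_H$), and (4) is itself homogeneous. The shrunk graph $G/H$ has vertex set $(V_G\setminus V_H)\cup\{v_H\}$; all vertices of $V_H$ are identified to $v_H$, edges of $E_H$ are dropped, and all other edges are kept with multiplicity, which gives the bijection $\varphi:E_G\setminus E_H\to E_{G/H}$ (applied also to edge subsets); $\varphi$ maps $\{\gamma\setminus E_H:\gamma\in\Gamma^*\}$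 bijectively onto $\Gamma_{G/H}$. For $\mu\in\mathcal{P}(\Gamma^* )$ the marginals are $\mu_H(\gamma_H)=\mu(\{\gamma\in\Gamma^*:\gamma\cap E_H=\gamma_H\})$ for $\gamma_H\in\Gamma_H$ and $\mu_{G/H}(\gamma')=\mu(\{\gamma\in\Gamma^*:\gamma\cap(E_G\setminus E_H)=\varphi^{-1}(\gamma')\})$ for $\gamma'\in\Gamma_{G/H}$. $\varphi^{-1}_*\mu_{G/H}$ is the push-forward of $\mu_{G/H}$ under $\gamma'\mapsto\varphi^{-1}(\gamma')$. For pmfs $\nu_1$ on subsets of $E_H$ and $\nu_2$ on subsets of $E_G\setminus E_H$, $(\nu_1\oplus\nu_2)(S)=\nu_1(S\cap E_H)\,\nu_2(S\setminus E_H)$ for $S\subset E_G$. *)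

theory Defs
  imports "HOL-Probability.Probability"
begin

record ('v, 'e) mgraph =
  verts :: "'v set"
  edges :: "'e set"
  ends :: "'e \<Rightarrow> 'v set"

text \<open>Parallel edges are distinct edge names with the same set of endpoints; a self-loop has a
  one-element set of endpoints. The values of \<open>ends\<close> outside \<open>edges\<close> are irrelevant.\<close>

definition multigraph :: "('v, 'e) mgraph \<Rightarrow> bool" where
  "multigraph G \<longleftrightarrow> finite (verts G) \<and> verts G \<noteq> {} \<and> finite (edges G) \<and>
     (\<forall>e\<in>edges G. ends G e \<subseteq> verts G \<and> card (ends G e) \<in> {1, 2})"

definition no_self_loops :: "('v, 'e) mgraph \<Rightarrow> bool" where
  "no_self_loops G \<longleftrightarrow> (\<forall>e\<in>edges G. card (ends G e) \<noteq> 1)"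

definition connected_mgraph :: "('v, 'e) mgraph \<Rightarrow> bool" where
  "connected_mgraph G \<longleftrightarrow>
     (\<forall>u\<in>verts G. \<forall>v\<in>verts G. (u, v) \<in> {(x, y). \<exists>e\<in>edges G. ends G e = {x, y}}\<^sup>*)"

text \<open>The cycle visits \<open>vs ! 0\<close>, \<open>vs ! 1\<close>, \<open>\<dots>\<close> and returns to \<open>vs ! 0\<close>, using the edge \<open>es ! i\<close> to
  leave \<open>vs ! i\<close>. A self-loop is a cycle of length one and a pair of parallel edges is a cycle of
  length two.\<close>

definition cycle :: "('v, 'e) mgraph \<Rightarrow> 'v list \<Rightarrow> 'e list \<Rightarrow> bool" where
  "cycle G vs es \<longleftrightarrow> es \<noteq> [] \<and> length vs = length es \<and> distinct vs \<and> distinct es \<and>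
     set es \<subseteq> edges G \<and>
     (\<forall>i<length es. ends G (es ! i) = {vs ! i, vs ! (Suc i mod length vs)})"

definition acyclic_mgraph :: "('v, 'e) mgraph \<Rightarrow> bool" where
  "acyclic_mgraph G \<longleftrightarrow> (\<nexists>vs es. cycle G vs es)"

definition spanning_trees :: "('v, 'e) mgraph \<Rightarrow> 'e set set" where
  "spanning_trees G = {\<gamma>. \<gamma> \<subseteq> edges G \<and>
     connected_mgraph (G\<lparr>edges := \<gamma>\<rparr>) \<and> acyclic_mgraph (G\<lparr>edges := \<gamma>\<rparr>)}"

definition is_subgraph :: "('v, 'e) mgraph \<Rightarrow> ('v, 'e) mgraph \<Rightarrow> bool" where
  "is_subgraph H G \<longleftrightarrow> multigraph H \<and> verts H \<subseteq> verts G \<and> edges H \<subseteq> edges G \<and>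
     (\<forall>e\<in>edges H. ends H e = ends G e)"

definition vertex_induced :: "('v, 'e) mgraph \<Rightarrow> ('v, 'e) mgraph \<Rightarrow> bool" where
  "vertex_induced H G \<longleftrightarrow> (\<forall>e\<in>edges G. ends G e \<subseteq> verts H \<longrightarrow> e \<in> edges H)"

definition pmfs_on :: "'a set \<Rightarrow> 'a pmf set" where
  "pmfs_on \<Gamma> = {\<mu>. set_pmf \<mu> \<subseteq> \<Gamma>}"

definition expected_overlap :: "'e set set \<Rightarrow> 'e set pmf \<Rightarrow> real" where
  "expected_overlap \<Gamma> \<mu> =
     (\<Sum>\<gamma>\<in>\<Gamma>. \<Sum>\<gamma>'\<in>\<Gamma>. real (card (\<gamma> \<inter> \<gamma>')) * pmf \<mu> \<gamma> * pmf \<mu> \<gamma>')"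

definition MEO :: "'e set set \<Rightarrow> real" where
  "MEO \<Gamma> = (LEAST x. \<exists>\<mu>\<in>pmfs_on \<Gamma>. x = expected_overlap \<Gamma> \<mu>)"

definition optimal :: "'e set set \<Rightarrow> 'e set pmf \<Rightarrow> bool" where
  "optimal \<Gamma> \<mu> \<longleftrightarrow> \<mu> \<in> pmfs_on \<Gamma> \<and>
     (\<forall>\<nu>\<in>pmfs_on \<Gamma>. expected_overlap \<Gamma> \<mu> \<le> expected_overlap \<Gamma> \<nu>)"

lemma optimal_MEO:
  assumes "optimal \<Gamma> \<mu>"
  shows "expected_overlap \<Gamma> \<mu> = MEO \<Gamma>"
  unfolding MEO_def using assms
  by (intro Least_equality[symmetric]) (auto simp: optimal_def)

definition edge_prob :: "'e set pmf \<Rightarrow> 'e \<Rightarrow> real" where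
  "edge_prob \<mu> e = measure_pmf.prob \<mu> {\<gamma>. e \<in> \<gamma>}"

lemma edge_prob_eq_sum:
  assumes "finite \<Gamma>" "\<mu> \<in> pmfs_on \<Gamma>"
  shows "edge_prob \<mu> e = (\<Sum>\<gamma> | \<gamma> \<in> \<Gamma> \<and> e \<in> \<gamma>. pmf \<mu> \<gamma>)"
proof -
  have "edge_prob \<mu> e = measure_pmf.prob \<mu> ({\<gamma>. e \<in> \<gamma>} \<inter> set_pmf \<mu>)"
    by (simp add: edge_prob_def measure_Int_set_pmf)
  also have "{\<gamma>. e \<in> \<gamma>} \<inter> set_pmf \<mu> = {\<gamma>. \<gamma> \<in> \<Gamma> \<and> e \<in> \<gamma>} \<inter> set_pmf \<mu>"
    using assms(2) by (auto simp: pmfs_on_def)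
  also have "measure_pmf.prob \<mu> \<dots> = measure_pmf.prob \<mu> {\<gamma>. \<gamma> \<in> \<Gamma> \<and> e \<in> \<gamma>}"
    by (rule measure_Int_set_pmf)
  also have "\<dots> = (\<Sum>\<gamma> | \<gamma> \<in> \<Gamma> \<and> e \<in> \<gamma>. pmf \<mu> \<gamma>)"
    using assms(1) by (simp add: measure_measure_pmf_finite)
  finally show ?thesis .
qed

text \<open>The edge probability common to all optimal pmfs on the spanning trees of \<open>G\<close>.\<close>

definition eta_star :: "('v, 'e) mgraph \<Rightarrow> 'e \<Rightarrow> real" where
  "eta_star G e = (THE x. \<exists>\<mu>. optimal (spanning_trees G) \<mu> \<and> x = edge_prob \<mu> e)"

definition homogeneous :: "('v, 'e) mgraph \<Rightarrow> bool" where
  "homogeneous G \<longleftrightarrow> (\<exists>c. \<forall>e\<in>edges G. eta_star G e = c)"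

definition fair_tree :: "('v, 'e) mgraph \<Rightarrow> 'e set \<Rightarrow> bool" where
  "fair_tree G \<gamma> \<longleftrightarrow> \<gamma> \<in> spanning_trees G \<and>
     (\<exists>\<mu>. optimal (spanning_trees G) \<mu> \<and> pmf \<mu> \<gamma> > 0)"

definition homogeneous_core :: "('v, 'e) mgraph \<Rightarrow> ('v, 'e) mgraph \<Rightarrow> bool" where
  "homogeneous_core G H \<longleftrightarrow>
     is_subgraph H G \<and> connected_mgraph H \<and>
     edges H \<noteq> {} \<and>
     (\<forall>\<gamma>. fair_tree G \<gamma> \<longrightarrow> \<gamma> \<inter> edges H \<in> spanning_trees H) \<and>
     vertex_induced H G \<and>
     homogeneous H"

text \<open>\<open>None\<close> is the vertex \<open>v\<^sub>H\<close> to which the vertices of \<open>H\<close> are identified. The edges of the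
  shrunk graph are named by \<open>\<phi>\<close>, which is meant to be injective on \<open>edges G - edges H\<close> and hence is
  the natural bijection between these edges and those of the shrunk graph.\<close>

definition shrunk_graph ::
  "('v, 'e) mgraph \<Rightarrow> ('v, 'e) mgraph \<Rightarrow> ('e \<Rightarrow> 'f) \<Rightarrow> ('v option, 'f) mgraph" where
  "shrunk_graph G H \<phi> =
     \<lparr>verts = Some ` (verts G - verts H) \<union> {None},
      edges = \<phi> ` (edges G - edges H),
      ends = (\<lambda>f. (\<lambda>v. if v \<in> verts H then None else Some v) `
                   ends G (inv_into (edges G - edges H) \<phi> f))\<rparr>"

definition Gamma_star :: "('v, 'e) mgraph \<Rightarrow> ('v, 'e) mgraph \<Rightarrow> 'e set set" where
  "Gamma_star G H = {\<gamma> \<in> spanning_trees G. \<gamma> \<inter> edges H \<in> spanning_trees H}"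

definition marginal_core :: "('v, 'e) mgraph \<Rightarrow> 'e set pmf \<Rightarrow> 'e set pmf" where
  "marginal_core H \<mu> = map_pmf (\<lambda>\<gamma>. \<gamma> \<inter> edges H) \<mu>"

definition marginal_shrunk ::
  "('v, 'e) mgraph \<Rightarrow> ('v, 'e) mgraph \<Rightarrow> ('e \<Rightarrow> 'f) \<Rightarrow> 'e set pmf \<Rightarrow> 'f set pmf" where
  "marginal_shrunk G H \<phi> \<mu> = map_pmf (\<lambda>\<gamma>. \<phi> ` (\<gamma> \<inter> (edges G - edges H))) \<mu>"

definition phi_inv ::
  "('v, 'e) mgraph \<Rightarrow> ('v, 'e) mgraph \<Rightarrow> ('e \<Rightarrow> 'f) \<Rightarrow> 'f set \<Rightarrow> 'e set" where
  "phi_inv G H \<phi> \<gamma>' = inv_into (edges G - edges H) \<phi> ` \<gamma>'"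

lemma pmf_marginal_core:
  assumes "\<mu> \<in> pmfs_on (Gamma_star G H)"
  shows "pmf (marginal_core H \<mu>) \<gamma>\<^sub>H =
    measure_pmf.prob \<mu> {\<gamma> \<in> Gamma_star G H. \<gamma> \<inter> edges H = \<gamma>\<^sub>H}"
  unfolding marginal_core_def pmf_map
  by (rule measure_pmf.finite_measure_eq_AE)
     (use assms in \<open>auto simp: AE_measure_pmf_iff pmfs_on_def\<close>)

lemma pmf_marginal_shrunk:
  assumes "\<mu> \<in> pmfs_on (Gamma_star G H)" "inj_on \<phi> (edges G - edges H)"
    and "\<gamma>' \<subseteq> edges (shrunk_graph G H \<phi>)"
  shows "pmf (marginal_shrunk G H \<phi> \<mu>) \<gamma>' =
    measure_pmf.prob \<mu> {\<gamma> \<in> Gamma_star G H. \<gamma> \<inter> (edges G - edges H) = phi_inv G H \<phi> \<gamma>'}"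
proof -
  have "\<phi> ` A = \<gamma>' \<longleftrightarrow> A = phi_inv G H \<phi> \<gamma>'" if "A \<subseteq> edges G - edges H" for A
    using that assms(2,3) inv_into_image_cancel[OF assms(2) that]
      image_inv_into_cancel[of \<phi> "edges G - edges H" "\<phi> ` (edges G - edges H)" \<gamma>']
    by (auto simp: phi_inv_def shrunk_graph_def)
  then show ?thesis
    unfolding marginal_shrunk_def pmf_map
    by (intro measure_pmf.finite_measure_eq_AE)
       (use assms in \<open>auto simp: AE_measure_pmf_iff pmfs_on_def\<close>)
qed

definition direct_sum_pmf :: "'e set \<Rightarrow> 'e set \<Rightarrow> 'e set pmf \<Rightarrow> 'e set pmf \<Rightarrow> 'e set pmf" where
  "direct_sum_pmf E E\<^sub>H \<nu>\<^sub>1 \<nu>\<^sub>2 =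
     embed_pmf (\<lambda>S. if S \<subseteq> E then pmf \<nu>\<^sub>1 (S \<inter> E\<^sub>H) * pmf \<nu>\<^sub>2 (S - E\<^sub>H) else 0)"

text \<open>The function given to \<open>embed_pmf\<close> is indeed a probability mass function.\<close>

lemma pmf_direct_sum_pmf:
  assumes "E\<^sub>H \<subseteq> E" "\<nu>\<^sub>1 \<in> pmfs_on (Pow E\<^sub>H)" "\<nu>\<^sub>2 \<in> pmfs_on (Pow (E - E\<^sub>H))"
  shows "pmf (direct_sum_pmf E E\<^sub>H \<nu>\<^sub>1 \<nu>\<^sub>2) S =
    (if S \<subseteq> E then pmf \<nu>\<^sub>1 (S \<inter> E\<^sub>H) * pmf \<nu>\<^sub>2 (S - E\<^sub>H) else 0)"
proof -
  define M where "M = map_pmf (\<lambda>(A, B). A \<union> B) (pair_pmf \<nu>\<^sub>1 \<nu>\<^sub>2)"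
  have supp: "A \<subseteq> E\<^sub>H" "B \<subseteq> E - E\<^sub>H" if "A \<in> set_pmf \<nu>\<^sub>1" "B \<in> set_pmf \<nu>\<^sub>2" for A B
    using that assms(2,3) by (auto simp: pmfs_on_def)
  have M: "pmf M S = (if S \<subseteq> E then pmf \<nu>\<^sub>1 (S \<inter> E\<^sub>H) * pmf \<nu>\<^sub>2 (S - E\<^sub>H) else 0)" for S
  proof -
    have "pmf M S = measure_pmf.prob (pair_pmf \<nu>\<^sub>1 \<nu>\<^sub>2)
        (if S \<subseteq> E then {(S \<inter> E\<^sub>H, S - E\<^sub>H)} else {})"
      unfolding M_def pmf_map
    proof (rule measure_pmf.finite_measure_eq_AE)
      show "AE x in measure_pmf (pair_pmf \<nu>\<^sub>1 \<nu>\<^sub>2).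
          (x \<in> (\<lambda>(A, B). A \<union> B) -` {S}) = (x \<in> (if S \<subseteq> E then {(S \<inter> E\<^sub>H, S - E\<^sub>H)} else {}))"
        unfolding AE_measure_pmf_iff
      proof
        fix x assume "x \<in> set_pmf (pair_pmf \<nu>\<^sub>1 \<nu>\<^sub>2)"
        then have x: "fst x \<subseteq> E\<^sub>H" "snd x \<subseteq> E - E\<^sub>H"
          using supp[of "fst x" "snd x"] by auto
        show "(x \<in> (\<lambda>(A, B). A \<union> B) -` {S}) =
            (x \<in> (if S \<subseteq> E then {(S \<inter> E\<^sub>H, S - E\<^sub>H)} else {}))"
          using assms(1) x by (cases x) (auto split: if_splits)
      qed
    qed auto
    also have "\<dots> = (if S \<subseteq> E then pmf \<nu>\<^sub>1 (S \<inter> E\<^sub>H) * pmf \<nu>\<^sub>2 (S - E\<^sub>H) else 0)"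
      by (simp add: measure_pmf_single pmf_pair)
    finally show ?thesis .
  qed
  have "direct_sum_pmf E E\<^sub>H \<nu>\<^sub>1 \<nu>\<^sub>2 = embed_pmf (pmf M)"
    unfolding direct_sum_pmf_def M[abs_def] ..
  also have "\<dots> = M"
    by (metis (no_types, lifting) td_pmf_embed_pmf type_definition.Rep_inverse)
  finally show ?thesis by (simp add: M)
qed

end

theory Submission
  imports Defs
begin

text \<open>
  Two facts carry the proof.

  The first is combinatorial: \<open>Gamma_star G H\<close> is a product. Once a spanning tree \<open>A\<close> of \<open>H\<close> is
  fixed, a set \<open>B\<close> of edges outside \<open>H\<close> completes it to a spanning tree of \<open>G\<close> exactly when the
  image of \<open>B\<close> is a spanning tree of \<open>G/H\<close>, and the condition on \<open>B\<close> is the same for all \<open>A\<close>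
  (\<open>spanning_tree_contract\<close>). Connectivity transfers because \<open>A\<close> already connects the vertices that
  the contraction identifies. Instead of transferring cycles, which contraction can shorten or
  pinch, acyclicity is replaced by its numerical equivalent: a connected edge set on
  \<open>n\<close> vertices is a tree iff it has \<open>n - 1\<close> edges (\<open>spanning_trees_iff_card\<close>). That equivalence
  comes from counting components: a new edge merges two components, unless it closes a cycle.

  The second is that the expected overlap of \<open>\<mu>\<close> equals \<open>\<Sum>e. P\<^sub>\<mu>(e \<in> \<gamma>)\<^sup>2\<close>, so it depends on \<open>\<mu>\<close> only
  through single-edge probabilities. These can be read off the two marginals of \<open>\<mu>\<close>, however they
  are coupled; hence on \<open>Gamma_star G H\<close> the overlap is the sum of the overlaps of the marginals
  (\<open>expected_overlap_split\<close>). As any pair of pmfs on the trees of \<open>H\<close> and of \<open>G/H\<close> arises as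
  marginals, namely of its direct sum, minimizing over \<open>Gamma_star G H\<close> means minimizing both
  summands independently.

  The defining property of a core says that fair trees lie in \<open>Gamma_star G H\<close>. So every optimal pmf
  of \<open>G\<close> is supported there, and since one exists (by compactness, and because a connected graph
  has a spanning tree), minimizing over \<open>Gamma_star G H\<close> is the same as minimizing over all
  spanning trees of \<open>G\<close>.
\<close>

section \<open>Counting connected components\<close>

definition adjacent :: "('e \<Rightarrow> 'v set) \<Rightarrow> 'e set \<Rightarrow> ('v \<times> 'v) set" where
  "adjacent d F = {(x, y). \<exists>e\<in>F. d e = {x, y}}"

definition components :: "('e \<Rightarrow> 'v set) \<Rightarrow> 'v set \<Rightarrow> 'e set \<Rightarrow> 'v set set" where
  "components d V F = (\<lambda>x. (adjacent d F)\<^sup>* `` {x}) ` V"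

lemma sym_adjacent: "sym (adjacent d F)"
  by (auto simp: adjacent_def sym_def insert_commute)

lemma adjacent_rtrancl_sym: "(x, y) \<in> (adjacent d F)\<^sup>* \<Longrightarrow> (y, x) \<in> (adjacent d F)\<^sup>*"
  using sym_adjacent sym_rtrancl by (metis symD)

lemma adjacent_mono: "F \<subseteq> F' \<Longrightarrow> adjacent d F \<subseteq> adjacent d F'"
  by (auto simp: adjacent_def)

lemma adjacent_insert:
  "d e = {u, v} \<Longrightarrow> adjacent d (insert e F) = insert (u, v) (insert (v, u) (adjacent d F))"
  by (auto simp: adjacent_def doubleton_eq_iff)

text \<open>A walk through a new edge \<open>uv\<close> begins and ends in the old components of \<open>u\<close> and \<open>v\<close>, so the new
  edge merges these two components and leaves all others alone.\<close>

lemma reachable_insert_iff: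
  fixes F :: "'e set"
  assumes "d e = {u, v}"
  defines "C \<equiv> (adjacent d F)\<^sup>* `` {u, v}"
  shows "(x, y) \<in> (adjacent d (insert e F))\<^sup>* \<longleftrightarrow> (x, y) \<in> (adjacent d F)\<^sup>* \<or> x \<in> C \<and> y \<in> C"
proof
  let ?R = "(adjacent d F)\<^sup>*" and ?R' = "(adjacent d (insert e F))\<^sup>*"
  have C: "w \<in> C \<longleftrightarrow> (u, w) \<in> ?R \<or> (v, w) \<in> ?R" for w
    by (auto simp: C_def)
  {
    assume "(x, y) \<in> ?R'"
    then show "(x, y) \<in> ?R \<or> x \<in> C \<and> y \<in> C"
    proof induction
      case base
      then show ?case by simp
    next
      case (step y z)
      have C_uv: "u \<in> C" "v \<in> C"
        by (simp_all add: C)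
      have C_x: "x \<in> C" if "(x, u) \<in> ?R \<or> (x, v) \<in> ?R"
        using that adjacent_rtrancl_sym C by metis
      have C_z: "z \<in> C" if "y \<in> C" "(y, z) \<in> adjacent d F"
        using that C rtrancl_into_rtrancl by metis
      have "(y, z) \<in> adjacent d F \<or> (y, z) = (u, v) \<or> (y, z) = (v, u)"
        using step.hyps(2) unfolding adjacent_insert[of d e u v, OF assms(1)] by auto
      then show ?case
      proof
        assume yz: "(y, z) \<in> adjacent d F"
        show ?thesis
          using step.IH C_z[OF _ yz] rtrancl_into_rtrancl[OF _ yz] by metis
      next
        assume "(y, z) = (u, v) \<or> (y, z) = (v, u)"
        then show ?thesis
          using step.IH C_uv C_x by auto
      qed
    qed
  next
    assume "(x, y) \<in> ?R \<or> x \<in> C \<and> y \<in> C"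
    moreover have sub: "(a, b) \<in> ?R'" if "(a, b) \<in> ?R" for a b
      using that rtrancl_mono[OF adjacent_mono[of F "insert e F" d]] by blast
    moreover have u: "(u, z) \<in> ?R'" if "z \<in> C" for z
    proof -
      have "(u, v) \<in> ?R'"
        unfolding adjacent_insert[of d e u v, OF assms(1)] by blast
      then show ?thesis
        using that C sub by (metis rtrancl_trans)
    qed
    ultimately show "(x, y) \<in> ?R'"
      using rtrancl_trans adjacent_rtrancl_sym by metis
  }
qed

text \<open>If \<open>u\<close> and \<open>v\<close> are already connected, the two merged components coincide.\<close>

lemma reachable_insert_redundant:
  assumes "d e = {u, v}" "(u, v) \<in> (adjacent d F)\<^sup>*"
  shows "(adjacent d (insert e F))\<^sup>* = (adjacent d F)\<^sup>*"
proof -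
  have closed: "(x, y) \<in> (adjacent d F)\<^sup>*"
    if "x \<in> (adjacent d F)\<^sup>* `` {u, v}" "y \<in> (adjacent d F)\<^sup>* `` {u, v}" for x y
  proof -
    have "(u, z) \<in> (adjacent d F)\<^sup>*" if "z \<in> (adjacent d F)\<^sup>* `` {u, v}" for z
      using that assms(2) by (blast intro: rtrancl_trans)
    then show ?thesis
      using that by (blast intro: rtrancl_trans adjacent_rtrancl_sym)
  qed
  have "(x, y) \<in> (adjacent d (insert e F))\<^sup>* \<longleftrightarrow> (x, y) \<in> (adjacent d F)\<^sup>*" for x y
    using reachable_insert_iff[of d e u v x y F, OF assms(1)] closed[of x y] by argo
  then show ?thesis
    by (intro equalityI subrelI) simp_all
qed

lemma components_insert_redundant:
  assumes "d e = {u, v}" "(u, v) \<in> (adjacent d F)\<^sup>*"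
  shows "components d V (insert e F) = components d V F"
  by (simp add: components_def reachable_insert_redundant[of d e u v, OF assms])

text \<open>Otherwise two distinct classes are replaced by their union, which is a class that was not
  there before.\<close>

lemma card_components_insert_joining:
  assumes "finite V" "d e = {u, v}" "u \<in> V" "v \<in> V" "(u, v) \<notin> (adjacent d F)\<^sup>*"
  shows "Suc (card (components d V (insert e F))) = card (components d V F)"
proof -
  define K where "K = (\<lambda>x. (adjacent d F)\<^sup>* `` {x})"
  define P where "P = components d V F"
  have same: "K x = K y" if "(x, y) \<in> (adjacent d F)\<^sup>*" for x y
    using that unfolding K_def by (blast intro: rtrancl_trans adjacent_rtrancl_sym)
  have self: "x \<in> K x" for x
    by (simp add: K_def)
  have P: "P = K ` V"
    by (simp add: P_def components_def K_def)
  have ne: "K u \<noteq> K v"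
    using assms(5) self[of v] by (auto simp: K_def)
  have cls: "(adjacent d (insert e F))\<^sup>* `` {x} =
      (if x \<in> K u \<union> K v then K u \<union> K v else K x)" for x
    using reachable_insert_iff[of d e u v, OF assms(2), of x _ F] same
    by (auto simp: K_def)
  have in_iff: "x \<in> K u \<union> K v \<longleftrightarrow> K x \<in> {K u, K v}" for x
    using same[of u x] same[of v x] self[of x] by (auto simp: K_def)
  have "components d V (insert e F) = insert (K u \<union> K v) (P - {K u, K v})"
    unfolding components_def cls P in_iff using assms(3) by (auto simp: image_iff)
  moreover have "K u \<union> K v \<notin> P - {K u, K v}"
  proof
    assume "K u \<union> K v \<in> P - {K u, K v}"
    then obtain x where x: "K u \<union> K v = K x" "K x \<noteq> K u"
      unfolding P by auto
    then have "u \<in> K x"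
      using self by blast
    then show False
      using same[of x u] x(2) by (simp add: K_def)
  qed
  moreover have "finite P" "{K u, K v} \<subseteq> P"
    using assms by (auto simp: P)
  moreover have "card {K u, K v} \<le> card P"
    using calculation(3,4) by (rule card_mono)
  moreover have "card {K u, K v} = 2"
    using ne by simp
  ultimately show ?thesis
    by (simp add: card_Diff_subset P_def[symmetric])
qed

lemma components_empty: "components d V {} = (\<lambda>x. {x}) ` V"
  by (simp add: components_def adjacent_def Image_def)

lemma card_components_empty: "card (components d V {}) = card V"
  by (simp add: components_empty card_image)

text \<open>The case \<open>u = v\<close> is a self-loop; contracting a subgraph that is not induced creates such loops.\<close>

definition edges_within :: "('e \<Rightarrow> 'v set) \<Rightarrow> 'v set \<Rightarrow> 'e set \<Rightarrow> bool" where
  "edges_within d V F \<longleftrightarrow> (\<forall>e\<in>F. \<exists>u\<in>V. \<exists>v\<in>V. d e = {u, v})"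

text \<open>Starting from \<open>card V\<close> isolated vertices, each edge lowers the number of components by at most
  one.\<close>

lemma card_vertices_le:
  assumes "finite V" "finite F" "edges_within d V F"
  shows "card V \<le> card (components d V F) + card F"
  using assms(2,3)
proof (induction F rule: finite_induct)
  case empty
  then show ?case by (simp add: card_components_empty)
next
  case (insert e F)
  then obtain u v where uv: "u \<in> V" "v \<in> V" "d e = {u, v}"
    by (auto simp: edges_within_def)
  have "card V \<le> card (components d V F) + card F"
    using insert by (simp add: edges_within_def)
  then show ?case
    using components_insert_redundant[of d e u v, OF uv(3), of F V] insert.hyps
      card_components_insert_joining[of V d e u v, OF assms(1) uv(3,1,2), of F]
    by (cases "(u, v) \<in> (adjacent d F)\<^sup>*") auto
qed

text \<open>If no edge is redundant, each edge lowers the number of components by exactly one. Redundancy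
  is stated without cycles here, so that the induction needs only monotonicity of reachability.\<close>

lemma card_vertices_forest:
  assumes "finite V" "finite F" "edges_within d V F"
    and "\<And>e u v. e \<in> F \<Longrightarrow> d e = {u, v} \<Longrightarrow> (u, v) \<notin> (adjacent d (F - {e}))\<^sup>*"
  shows "card V = card (components d V F) + card F"
  using assms(2,3,4)
proof (induction F rule: finite_induct)
  case empty
  then show ?case by (simp add: card_components_empty)
next
  case (insert e F)
  obtain u v where uv: "u \<in> V" "v \<in> V" "d e = {u, v}"
    using insert.prems(1) by (auto simp: edges_within_def)
  have "card V = card (components d V F) + card F"
  proof (rule insert.IH)
    show "edges_within d V F"
      using insert.prems(1) by (simp add: edges_within_def)
    fix e' u' v' assume e': "e' \<in> F" "d e' = {u', v'}"
    have "(adjacent d (F - {e'}))\<^sup>* \<subseteq> (adjacent d (insert e F - {e'}))\<^sup>*"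
      by (intro rtrancl_mono adjacent_mono) auto
    then show "(u', v') \<notin> (adjacent d (F - {e'}))\<^sup>*"
      using insert.prems(2)[of e' u' v'] e' by blast
  qed
  moreover have "(u, v) \<notin> (adjacent d F)\<^sup>*"
    using insert.prems(2)[OF _ uv(3)] insert.hyps by simp
  ultimately show ?case
    using insert.hyps card_components_insert_joining[of V d e u v, OF assms(1) uv(3,1,2), of F] by simp
qed

section \<open>Cycles and redundant edges\<close>

text \<open>Prepend the edges of a walk one at a time; whenever the new vertex \<open>x\<close> is already on the path,
  drop the detour before it.\<close>

lemma simple_path_exists:
  assumes "(x, y) \<in> (adjacent d F)\<^sup>*"
  shows "\<exists>vs es. length vs = Suc (length es) \<and> distinct vs \<and> set es \<subseteq> F \<and> hd vs = x \<and> last vs = y \<and>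
    (\<forall>i<length es. d (es ! i) = {vs ! i, vs ! Suc i})"
  using assms
proof (induction rule: converse_rtrancl_induct)
  case base
  show ?case
    by (rule exI[of _ "[y]"], rule exI[of _ "[]"]) simp
next
  case (step x z)
  obtain vs es where p: "length vs = Suc (length es)" "distinct vs" "set es \<subseteq> F"
    "hd vs = z" "last vs = y" "\<And>i. i < length es \<Longrightarrow> d (es ! i) = {vs ! i, vs ! Suc i}"
    using step.IH by blast
  obtain e where e: "e \<in> F" "d e = {x, z}"
    using step.hyps(1) by (auto simp: adjacent_def)
  show ?case
  proof (cases "x \<in> set vs")
    case True
    then obtain k where k: "k < length vs" "vs ! k = x"
      by (auto simp: in_set_conv_nth)
    show ?thesis
      by (rule exI[of _ "drop k vs"], rule exI[of _ "drop k es"])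
        (use k p in \<open>auto simp: hd_drop_conv_nth dest: in_set_dropD\<close>)
  next
    case False
    have ne: "vs \<noteq> []"
      using p(1) by auto
    have "d ((e # es) ! i) = {(x # vs) ! i, (x # vs) ! Suc i}" if "i < Suc (length es)" for i
      using that p(1,4,6) e(2) ne by (cases i) (auto simp: hd_conv_nth)
    then show ?thesis
      by (intro exI[of _ "x # vs"] exI[of _ "e # es"]) (use p e False ne in auto)
  qed
qed

text \<open>The simple path that bypasses \<open>e\<close>, closed up by \<open>e\<close>, is a cycle. This also covers a loop,
  where the path has a single vertex.\<close>

lemma cycle_if_redundant_edge:
  assumes "e \<in> F" "ends G e = {u, v}" "(u, v) \<in> (adjacent (ends G) (F - {e}))\<^sup>*"
  shows "\<exists>vs es. cycle (G\<lparr>edges := F\<rparr>) vs es"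
proof -
  obtain vs es where p: "length vs = Suc (length es)" "distinct vs" "set es \<subseteq> F - {e}"
    "hd vs = u" "last vs = v" "\<And>i. i < length es \<Longrightarrow> ends G (es ! i) = {vs ! i, vs ! Suc i}"
    using simple_path_exists[OF assms(3)] by blast
  \<comment> \<open>Edges on a path with distinct vertices differ because their pairs of ends do.\<close>
  have "es ! i \<noteq> es ! j" if "i < j" "j < length es" for i j
  proof
    assume "es ! i = es ! j"
    then have "{vs ! i, vs ! Suc i} = {vs ! j, vs ! Suc j}"
      using p(6)[of i] p(6)[of j] that by simp
    then have "vs ! i = vs ! j \<or> vs ! i = vs ! Suc j"
      by blast
    then show False
      using that p(1,2) by (auto simp: nth_eq_iff_index_eq)
  qed
  then have "distinct es"
    by (metis distinct_conv_nth nat_neq_iff)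
  moreover have "vs \<noteq> []"
    using p(1) by auto
  then have "vs ! 0 = u" "vs ! length es = v"
    using p(1,4,5) by (auto simp: hd_conv_nth last_conv_nth)
  ultimately have "ends G ((es @ [e]) ! i) = {vs ! i, vs ! (Suc i mod length vs)}"
    if "i < length (es @ [e])" for i
    using that p(1,6) assms(2)
    by (cases "i = length es") (auto simp: nth_append insert_commute)
  then have "cycle (G\<lparr>edges := F\<rparr>) vs (es @ [e])"
    unfolding cycle_def using p(1-3) assms(1) \<open>distinct es\<close> by auto
  then show ?thesis by blast
qed

text \<open>The rest of the cycle is a detour around its last edge.\<close>

lemma redundant_edge_if_cycle:
  assumes "cycle (G\<lparr>edges := F\<rparr>) vs es"
  shows "\<exists>e u v. e \<in> F \<and> ends G e = {u, v} \<and> (u, v) \<in> (adjacent (ends G) (F - {e}))\<^sup>*"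
proof -
  obtain m where m: "length es = Suc m"
    using assms by (cases es) (auto simp: cycle_def)
  have len: "length vs = Suc m" and es: "distinct es" "set es \<subseteq> F"
    and ends: "\<And>i. i < Suc m \<Longrightarrow> ends G (es ! i) = {vs ! i, vs ! (Suc i mod Suc m)}"
    using assms m by (auto simp: cycle_def)
  let ?R = "adjacent (ends G) (F - {es ! m})"
  have "(vs ! 0, vs ! k) \<in> ?R\<^sup>*" if "k \<le> m" for k
    using that
  proof (induction k)
    case (Suc k)
    have "es ! k \<in> F - {es ! m}"
      using es Suc.prems m nth_mem[of k es] by (auto simp: nth_eq_iff_index_eq)
    moreover have "ends G (es ! k) = {vs ! k, vs ! Suc k}"
      using ends[of k] Suc.prems by simp
    ultimately have "(vs ! k, vs ! Suc k) \<in> ?R"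
      by (auto simp: adjacent_def)
    then show ?case
      using Suc by (auto intro: rtrancl_into_rtrancl)
  qed simp
  then have "(vs ! 0, vs ! m) \<in> ?R\<^sup>*" by simp
  moreover have "ends G (es ! m) = {vs ! 0, vs ! m}"
    using ends[of m] by (simp add: insert_commute)
  moreover have "es ! m \<in> F"
    using es m nth_mem[of m es] by auto
  ultimately show ?thesis by blast
qed

section \<open>Spanning trees\<close>

lemma connected_edges_iff:
  "connected_mgraph (G\<lparr>edges := F\<rparr>) \<longleftrightarrow>
    (\<forall>u\<in>verts G. \<forall>v\<in>verts G. (u, v) \<in> (adjacent (ends G) F)\<^sup>*)"
  by (simp add: connected_mgraph_def adjacent_def)

lemma multigraph_edges_within:
  assumes "multigraph G" "F \<subseteq> edges G"
  shows "edges_within (ends G) (verts G) F"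
  unfolding edges_within_def
proof
  fix e assume "e \<in> F"
  then have "ends G e \<subseteq> verts G" "card (ends G e) = 1 \<or> card (ends G e) = 2"
    using assms by (auto simp: multigraph_def)
  then show "\<exists>u\<in>verts G. \<exists>v\<in>verts G. ends G e = {u, v}"
    by (auto simp: card_1_singleton_iff card_2_iff)
qed

lemma card_components_connected:
  assumes "verts G \<noteq> {}" "connected_mgraph (G\<lparr>edges := F\<rparr>)" "edges_within (ends G) (verts G) F"
  shows "card (components (ends G) (verts G) F) = 1"
proof -
  have sub: "adjacent (ends G) F \<subseteq> verts G \<times> verts G"
    using assms(3) by (fastforce simp: adjacent_def edges_within_def doubleton_eq_iff)
  have "(adjacent (ends G) F)\<^sup>* `` {u} = verts G" if "u \<in> verts G" for u
  proof
    show "(adjacent (ends G) F)\<^sup>* `` {u} \<subseteq> verts G"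
      using that sub by (auto elim!: rtrancl_induct)
  qed (use assms(2) that in \<open>auto simp: connected_edges_iff\<close>)
  then have "components (ends G) (verts G) F = {verts G}"
    using assms(1) unfolding components_def by auto
  then show ?thesis by simp
qed

text \<open>A connected edge set has a single component. With the two counting lemmas this gives at least
  \<open>n - 1\<close> edges in general and exactly \<open>n - 1\<close> without cycles; and if there are \<open>n - 1\<close> edges but
  also a cycle, one edge of it could be removed without disconnecting, which leaves too few edges.\<close>

lemma spanning_trees_iff_card:
  assumes "multigraph G"
  shows "\<gamma> \<in> spanning_trees G \<longleftrightarrow>
    \<gamma> \<subseteq> edges G \<and> connected_mgraph (G\<lparr>edges := \<gamma>\<rparr>) \<and> Suc (card \<gamma>) = card (verts G)"
proof -
  have "acyclic_mgraph (G\<lparr>edges := \<gamma>\<rparr>) \<longleftrightarrow> Suc (card \<gamma>) = card (verts G)"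
    if sub: "\<gamma> \<subseteq> edges G" and con: "connected_mgraph (G\<lparr>edges := \<gamma>\<rparr>)"
  proof -
    have fin: "finite (verts G)" "finite \<gamma>" and ne: "verts G \<noteq> {}"
      using assms finite_subset[OF sub] by (auto simp: multigraph_def)
    note within = multigraph_edges_within[OF assms]
    have one: "card (components (ends G) (verts G) \<gamma>) = 1"
      by (rule card_components_connected[OF ne con within[OF sub]])
    show ?thesis
    proof
      assume acyclic: "acyclic_mgraph (G\<lparr>edges := \<gamma>\<rparr>)"
      have "(u, v) \<notin> (adjacent (ends G) (\<gamma> - {e}))\<^sup>*" if "e \<in> \<gamma>" "ends G e = {u, v}" for e u v
        using cycle_if_redundant_edge[of e \<gamma> G u v] that acyclic
        unfolding acyclic_mgraph_def by metis
      then have "card (verts G) = card (components (ends G) (verts G) \<gamma>) + card \<gamma>"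
        by (rule card_vertices_forest[OF fin within[OF sub]])
      then show "Suc (card \<gamma>) = card (verts G)"
        using one by simp
    next
      assume card: "Suc (card \<gamma>) = card (verts G)"
      show "acyclic_mgraph (G\<lparr>edges := \<gamma>\<rparr>)"
      proof (rule ccontr)
        assume "\<not> acyclic_mgraph (G\<lparr>edges := \<gamma>\<rparr>)"
        then obtain e u v where e: "e \<in> \<gamma>" "ends G e = {u, v}"
          "(u, v) \<in> (adjacent (ends G) (\<gamma> - {e}))\<^sup>*"
          using redundant_edge_if_cycle unfolding acyclic_mgraph_def by metis
        have "card (components (ends G) (verts G) (\<gamma> - {e})) = 1"
          using components_insert_redundant[of "ends G" e u v, OF e(2,3), of "verts G"] one e(1)
          by (simp add: insert_absorb)
        moreover have "card (verts G) \<le>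
            card (components (ends G) (verts G) (\<gamma> - {e})) + card (\<gamma> - {e})"
          using sub fin by (intro card_vertices_le within) auto
        moreover have "card \<gamma> = Suc (card (\<gamma> - {e}))"
          using card_Suc_Diff1[OF fin(2) e(1)] by simp
        ultimately show False
          using card by simp
      qed
    qed
  qed
  then show ?thesis
    by (auto simp: spanning_trees_def)
qed

text \<open>A minimal connected edge set has no cycle.\<close>

lemma spanning_trees_nonempty:
  assumes "multigraph G" "connected_mgraph G"
  shows "spanning_trees G \<noteq> {}"
proof -
  define S where "S = {F. F \<subseteq> edges G \<and> connected_mgraph (G\<lparr>edges := F\<rparr>)}"
  have "finite S"
    using assms(1) by (auto simp: S_def multigraph_def)
  moreover have "edges G \<in> S"
    using assms(2) by (simp add: S_def)
  ultimately obtain F where F: "F \<in> S" and min: "\<And>F'. F' \<in> S \<Longrightarrow> F' \<subseteq> F \<Longrightarrow> F' = F"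
    using finite_has_minimal[of S] by blast
  have "acyclic_mgraph (G\<lparr>edges := F\<rparr>)"
  proof (rule ccontr)
    assume "\<not> acyclic_mgraph (G\<lparr>edges := F\<rparr>)"
    then obtain e u v where e: "e \<in> F" "ends G e = {u, v}"
      "(u, v) \<in> (adjacent (ends G) (F - {e}))\<^sup>*"
      using redundant_edge_if_cycle unfolding acyclic_mgraph_def by metis
    have "F - {e} \<in> S"
      using reachable_insert_redundant[of "ends G" e u v, OF e(2,3)] F e(1)
      by (auto simp: S_def connected_edges_iff insert_absorb)
    then show False
      using min[of "F - {e}"] e(1) by blast
  qed
  then show ?thesis
    using F by (auto simp: S_def spanning_trees_def)
qed

section \<open>Expected overlap and its minimizers\<close>

lemma finite_edges: "multigraph G \<Longrightarrow> finite (edges G)"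
  by (simp add: multigraph_def)

lemma spanning_trees_subset_Pow: "spanning_trees G \<subseteq> Pow (edges G)"
  by (auto simp: spanning_trees_def)

lemma finite_spanning_trees: "multigraph G \<Longrightarrow> finite (spanning_trees G)"
  by (rule finite_subset[OF spanning_trees_subset_Pow]) (simp add: finite_edges)

text \<open>Count the overlap edge by edge: for two independent samples from \<open>\<mu>\<close>, an edge lies in both with
  probability \<open>(edge_prob \<mu> e)\<^sup>2\<close>.\<close>

lemma expected_overlap_eq_sum_edge_prob:
  assumes "finite E" "\<Gamma> \<subseteq> Pow E" "\<mu> \<in> pmfs_on \<Gamma>"
  shows "expected_overlap \<Gamma> \<mu> = (\<Sum>e\<in>E. (edge_prob \<mu> e)\<^sup>2)"
proof -
  have fin: "finite \<Gamma>"
    using assms(1,2) finite_subset by blast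
  let ?p = "\<lambda>e \<gamma>. of_bool (e \<in> \<gamma>) * pmf \<mu> \<gamma>"
  have prob: "edge_prob \<mu> e = (\<Sum>\<gamma>\<in>\<Gamma>. ?p e \<gamma>)" for e
    unfolding edge_prob_eq_sum[OF fin assms(3)]
    using fin by (intro sum.mono_neutral_cong_left) auto
  have card: "real (card (\<gamma> \<inter> \<gamma>')) = (\<Sum>e\<in>E. of_bool (e \<in> \<gamma>) * of_bool (e \<in> \<gamma>'))"
    if "\<gamma> \<in> \<Gamma>" for \<gamma> \<gamma>'
  proof -
    have "E \<inter> (\<gamma> \<inter> \<gamma>') = \<gamma> \<inter> \<gamma>'"
      using that assms(2) by auto
    then have "real (card (\<gamma> \<inter> \<gamma>')) = (\<Sum>e\<in>E \<inter> (\<gamma> \<inter> \<gamma>'). 1)"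
      by simp
    also have "\<dots> = (\<Sum>e\<in>E. of_bool (e \<in> \<gamma>) * of_bool (e \<in> \<gamma>'))"
      unfolding sum.inter_restrict[OF assms(1)] by (intro sum.cong) auto
    finally show ?thesis .
  qed
  have "expected_overlap \<Gamma> \<mu> = (\<Sum>\<gamma>\<in>\<Gamma>. \<Sum>\<gamma>'\<in>\<Gamma>. \<Sum>e\<in>E. ?p e \<gamma> * ?p e \<gamma>')"
    unfolding expected_overlap_def
    by (intro sum.cong refl) (simp add: card sum_distrib_left sum_distrib_right ac_simps)
  also have "\<dots> = (\<Sum>\<gamma>\<in>\<Gamma>. \<Sum>e\<in>E. \<Sum>\<gamma>'\<in>\<Gamma>. ?p e \<gamma> * ?p e \<gamma>')"
    by (intro sum.cong refl sum.swap)
  also have "\<dots> = (\<Sum>e\<in>E. \<Sum>\<gamma>\<in>\<Gamma>. \<Sum>\<gamma>'\<in>\<Gamma>. ?p e \<gamma> * ?p e \<gamma>')"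
    by (rule sum.swap)
  also have "\<dots> = (\<Sum>e\<in>E. (edge_prob \<mu> e)\<^sup>2)"
    by (simp only: prob power2_eq_square sum_product)
  finally show ?thesis .
qed

text \<open>The overlap is continuous in the mass function, and the mass functions on a finite set form a
  compact simplex.\<close>

lemma optimal_exists:
  assumes "finite \<Gamma>" "\<Gamma> \<noteq> {}"
  shows "\<exists>\<mu>. optimal \<Gamma> \<mu>"
proof -
  \<comment> \<open>Masses outside \<open>\<Gamma>\<close> are pinned to \<open>0\<close>, which makes the simplex a closed part of a product of
    compact sets indexed by the whole type.\<close>
  define I where "I = (\<lambda>\<gamma>. if \<gamma> \<in> \<Gamma> then {0..1} else {0::real})"
  define S where "S = Pi\<^sub>E UNIV I \<inter> {p. (\<Sum>\<gamma>\<in>\<Gamma>. p \<gamma>) = 1}"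
  define f where "f = (\<lambda>p::'a set \<Rightarrow> real.
    \<Sum>\<gamma>\<in>\<Gamma>. \<Sum>\<gamma>'\<in>\<Gamma>. real (card (\<gamma> \<inter> \<gamma>')) * p \<gamma> * p \<gamma>')"
  have coord: "continuous_on T (\<lambda>p::'a set \<Rightarrow> real. p \<gamma>)" for T \<gamma>
    by (rule continuous_on_subset[OF continuous_on_product_coordinates]) simp
  have S_pmf: "pmf \<mu> \<in> S" if "\<mu> \<in> pmfs_on \<Gamma>" for \<mu>
    using that assms(1)
    by (auto simp: S_def I_def pmfs_on_def pmf_le_1 sum_pmf_eq_1 set_pmf_iff)
  have "compact (Pi\<^sub>E UNIV I)"
    using compactin_PiE[of "\<lambda>_::'a set. euclidean :: real topology" UNIV I]
    by (auto simp: I_def euclidean_product_topology)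
  moreover have "closed {p::'a set \<Rightarrow> real. (\<Sum>\<gamma>\<in>\<Gamma>. p \<gamma>) = 1}"
    by (intro closed_Collect_eq continuous_intros coord)
  ultimately have "compact S"
    unfolding S_def by (rule compact_Int_closed)
  moreover obtain \<gamma> where "\<gamma> \<in> \<Gamma>"
    using assms(2) by blast
  then have "S \<noteq> {}"
    using S_pmf[of "return_pmf \<gamma>"] by (auto simp: pmfs_on_def)
  moreover have "continuous_on S f"
    unfolding f_def by (intro continuous_intros coord)
  ultimately obtain p where p: "p \<in> S" and min: "\<And>q. q \<in> S \<Longrightarrow> f p \<le> f q"
    using continuous_attains_inf[of S f] by blast
  have p0: "p \<gamma> = 0" if "\<gamma> \<notin> \<Gamma>" for \<gamma>
    using p that by (auto simp: S_def I_def PiE_iff dest!: spec[of _ \<gamma>])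
  have nonneg: "0 \<le> p \<gamma>" for \<gamma>
    using p by (cases "\<gamma> \<in> \<Gamma>") (auto simp: S_def I_def PiE_iff dest!: spec[of _ \<gamma>])
  have "(\<integral>\<^sup>+\<gamma>. ennreal (p \<gamma>) \<partial>count_space UNIV) = (\<Sum>\<gamma>\<in>\<Gamma>. ennreal (p \<gamma>))"
    using assms(1) p0 by (intro nn_integral_count_space') auto
  also have "\<dots> = 1"
    using p nonneg by (simp add: sum_ennreal S_def)
  finally have pmf: "pmf (embed_pmf p) = p"
    using nonneg by (intro ext pmf_embed_pmf) auto
  have "\<gamma> \<in> \<Gamma>" if "\<gamma> \<in> set_pmf (embed_pmf p)" for \<gamma>
    using p0[of \<gamma>] that by (cases "\<gamma> \<in> \<Gamma>") (simp_all add: set_pmf_iff pmf)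
  then have "embed_pmf p \<in> pmfs_on \<Gamma>"
    by (auto simp: pmfs_on_def)
  moreover have "expected_overlap \<Gamma> \<nu> = f (pmf \<nu>)" for \<nu>
    by (simp add: expected_overlap_def f_def)
  ultimately show ?thesis
    using min S_pmf pmf unfolding optimal_def by metis
qed

section \<open>Contracting a subgraph\<close>

locale contraction =
  fixes G H :: "('v, 'e) mgraph" and \<phi> :: "'e \<Rightarrow> 'f"
  assumes multigraph_G: "multigraph G"
    and subgraph: "is_subgraph H G"
    and inj_\<phi>: "inj_on \<phi> (edges G - edges H)"
begin

abbreviation Q :: "('v option, 'f) mgraph" where
  "Q \<equiv> shrunk_graph G H \<phi>"

definition proj :: "'v \<Rightarrow> 'v option" where
  "proj v = (if v \<in> verts H then None else Some v)"

lemma multigraph_H: "multigraph H" and verts_H: "verts H \<subseteq> verts G"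
  and edges_H: "edges H \<subseteq> edges G" and ends_H: "e \<in> edges H \<Longrightarrow> ends H e = ends G e"
  using subgraph by (auto simp: is_subgraph_def)

lemma verts_Q: "verts Q = proj ` verts G"
  using verts_H multigraph_H by (auto simp: shrunk_graph_def proj_def multigraph_def image_iff)

lemma ends_Q: "e \<in> edges G - edges H \<Longrightarrow> ends Q (\<phi> e) = proj ` ends G e"
  using inj_\<phi> by (simp add: shrunk_graph_def proj_def[abs_def])

lemma edges_Q: "edges Q = \<phi> ` (edges G - edges H)"
  by (simp add: shrunk_graph_def)

lemma multigraph_Q: "multigraph Q"
proof -
  have "proj ` ends G e \<subseteq> proj ` verts G \<and> card (proj ` ends G e) \<in> {1, 2}"
    if e: "e \<in> edges G" for e
  proof -
    obtain u v where "u \<in> verts G" "v \<in> verts G" "ends G e = {u, v}"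
      using multigraph_edges_within[OF multigraph_G order_refl] e
      unfolding edges_within_def by blast
    then show ?thesis
      by (cases "proj u = proj v") auto
  qed
  then show ?thesis
    using multigraph_G by (auto simp: multigraph_def verts_Q edges_Q ends_Q)
qed

text \<open>The \<open>Suc\<close> accounts for the new vertex \<open>None\<close>.\<close>

lemma card_verts_Q: "card (verts Q) + card (verts H) = Suc (card (verts G))"
proof -
  have fin: "finite (verts G)" "finite (verts H)"
    using multigraph_G multigraph_H by (auto simp: multigraph_def)
  then have "card (verts Q) = Suc (card (verts G - verts H))"
    by (simp add: shrunk_graph_def card_image)
  also have "card (verts G - verts H) = card (verts G) - card (verts H)"
    using fin verts_H by (simp add: card_Diff_subset)
  finally show ?thesis
    using card_mono[OF fin(1) verts_H] by simp
qed

text \<open>A walk in \<open>G\<close> projects to a walk in the contracted graph, where steps along \<open>A\<close> become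
  stationary. Conversely, a walk in the contracted graph lifts edge by edge; wherever the lifted
  edges do not fit together, both of the ends to be joined project to \<open>None\<close>, so they lie in \<open>H\<close> and
  \<open>A\<close> connects them.\<close>

lemma connected_contract:
  assumes A: "A \<subseteq> edges H" "connected_mgraph (H\<lparr>edges := A\<rparr>)"
    and B: "B \<subseteq> edges G - edges H"
  shows "connected_mgraph (G\<lparr>edges := A \<union> B\<rparr>) \<longleftrightarrow> connected_mgraph (Q\<lparr>edges := \<phi> ` B\<rparr>)"
proof -
  define R where "R = adjacent (ends G) (A \<union> B)"
  define T where "T = adjacent (ends Q) (\<phi> ` B)"
  have adj_A: "adjacent (ends H) A = adjacent (ends G) A"
    using A(1) ends_H by (fastforce simp: adjacent_def)
  have core: "(u, v) \<in> R\<^sup>*" if "proj u = proj v" for u v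
  proof (cases "u = v")
    case False
    then have "u \<in> verts H" "v \<in> verts H"
      using that by (auto simp: proj_def split: if_splits)
    then have "(u, v) \<in> (adjacent (ends G) A)\<^sup>*"
      using A(2) by (simp add: connected_edges_iff adj_A)
    then show ?thesis
      using rtrancl_mono[OF adjacent_mono[of A "A \<union> B" "ends G"]] unfolding R_def by blast
  qed simp
  have proj_R: "(proj u, proj v) \<in> T\<^sup>*" if "(u, v) \<in> R\<^sup>*" for u v
    using that
  proof induction
    case (step x y)
    then obtain e where e: "e \<in> A \<or> e \<in> B" "ends G e = {x, y}"
      by (auto simp: R_def adjacent_def)
    from e(1) have "(proj x, proj y) \<in> T\<^sup>*"
    proof
      assume "e \<in> A"
      then have "e \<in> edges H" "ends H e = {x, y}"
        using A(1) ends_H[of e] e(2) by auto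
      then have "{x, y} \<subseteq> verts H"
        using multigraph_H unfolding multigraph_def by metis
      then show ?thesis by (simp add: proj_def)
    next
      assume "e \<in> B"
      then have "ends Q (\<phi> e) = {proj x, proj y}"
        using ends_Q[of e] B e(2) by auto
      then show ?thesis
        using \<open>e \<in> B\<close> unfolding T_def adjacent_def by blast
    qed
    then show ?case
      using step.IH by (rule rtrancl_trans[rotated])
  qed simp
  have lift: "(u, v) \<in> R\<^sup>*" if "(a, b) \<in> T\<^sup>*" "proj u = a" "proj v = b" for a b u v
    using that
  proof (induction arbitrary: v)
    case base
    then show ?case by (simp add: core)
  next
    case (step b c)
    then obtain e where e: "e \<in> B" "ends Q (\<phi> e) = {b, c}"
      by (auto simp: T_def adjacent_def)
    then have img: "proj ` ends G e = {b, c}"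
      using ends_Q[of e] B by auto
    obtain x' y' where "ends G e = {x', y'}"
      using multigraph_edges_within[OF multigraph_G order_refl] e(1) B
      unfolding edges_within_def by blast
    then obtain x y where xy: "ends G e = {x, y}" "proj x = b" "proj y = c"
      using img by (auto simp: doubleton_eq_iff)
    then have "(x, y) \<in> R"
      using e(1) by (auto simp: R_def adjacent_def)
    moreover have "(u, x) \<in> R\<^sup>*"
      using step.IH[OF step.prems(1) xy(2)] .
    moreover have "(y, v) \<in> R\<^sup>*"
      using core xy(3) step.prems(2) by simp
    ultimately show ?case
      by (meson rtrancl_into_rtrancl rtrancl_trans)
  qed
  have "(u, v) \<in> R\<^sup>* \<longleftrightarrow> (proj u, proj v) \<in> T\<^sup>*" for u v
    by (rule iffI[OF proj_R lift[OF _ refl refl]])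
  then show ?thesis
    by (simp add: connected_edges_iff verts_Q R_def T_def)
qed

text \<open>Both connectivity and the number of edges transfer: the edges of \<open>A\<close> account for exactly the
  vertices lost in the contraction.\<close>

lemma spanning_tree_contract:
  assumes A: "A \<in> spanning_trees H" and B: "B \<subseteq> edges G - edges H"
  shows "A \<union> B \<in> spanning_trees G \<longleftrightarrow> \<phi> ` B \<in> spanning_trees Q"
proof -
  have A': "A \<subseteq> edges H" "connected_mgraph (H\<lparr>edges := A\<rparr>)" "Suc (card A) = card (verts H)"
    using A by (simp_all add: spanning_trees_iff_card[OF multigraph_H])
  have fin: "finite A" "finite B"
    using multigraph_G multigraph_H finite_subset[OF A'(1)] finite_subset[OF B]
    by (auto simp: multigraph_def)
  have "card (A \<union> B) = card A + card B"
    using fin A'(1) B by (intro card_Un_disjoint) auto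
  moreover have "card (\<phi> ` B) = card B"
    by (rule card_image) (rule inj_on_subset[OF inj_\<phi> B])
  ultimately have "Suc (card (A \<union> B)) = card (verts G) \<longleftrightarrow> Suc (card (\<phi> ` B)) = card (verts Q)"
    using A'(3) card_verts_Q by linarith
  moreover have "A \<union> B \<subseteq> edges G" "\<phi> ` B \<subseteq> edges Q"
    using A'(1) B edges_H by (auto simp only: edges_Q)
  ultimately show ?thesis
    unfolding spanning_trees_iff_card[OF multigraph_G] spanning_trees_iff_card[OF multigraph_Q]
    using connected_contract[OF A'(1,2) B] by simp
qed

lemma phi_image_phi_inv:
  assumes "C \<subseteq> edges Q"
  shows "\<phi> ` phi_inv G H \<phi> C = C" "phi_inv G H \<phi> C \<subseteq> edges G - edges H"
proof -
  have C: "C \<subseteq> \<phi> ` (edges G - edges H)"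
    using assms by (simp only: edges_Q)
  show "\<phi> ` phi_inv G H \<phi> C = C"
    unfolding phi_inv_def by (rule image_inv_into_cancel[OF refl C])
  show "phi_inv G H \<phi> C \<subseteq> edges G - edges H"
    unfolding phi_inv_def by (rule image_subsetI, rule inv_into_into, rule subsetD[OF C])
qed

section \<open>Marginals and gluing\<close>

lemma edge_prob_marginal_core:
  "e \<in> edges H \<Longrightarrow> edge_prob (marginal_core H \<mu>) e = edge_prob \<mu> e"
  by (simp add: edge_prob_def marginal_core_def vimage_def)

lemma edge_prob_marginal_shrunk:
  assumes "e \<in> edges G - edges H"
  shows "edge_prob (marginal_shrunk G H \<phi> \<mu>) (\<phi> e) = edge_prob \<mu> e"
proof -
  have "\<phi> e \<in> \<phi> ` (\<gamma> \<inter> (edges G - edges H)) \<longleftrightarrow> e \<in> \<gamma>" for \<gamma>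
    using inj_on_image_mem_iff[OF inj_\<phi> assms, of "\<gamma> \<inter> (edges G - edges H)"] assms by auto
  then show ?thesis
    by (simp add: edge_prob_def marginal_shrunk_def vimage_def)
qed

lemma marginals_on_trees:
  assumes "\<mu> \<in> pmfs_on (Gamma_star G H)"
  shows "marginal_core H \<mu> \<in> pmfs_on (spanning_trees H)"
    and "marginal_shrunk G H \<phi> \<mu> \<in> pmfs_on (spanning_trees Q)"
proof -
  have "\<gamma> \<inter> edges H \<in> spanning_trees H"
      "\<phi> ` (\<gamma> \<inter> (edges G - edges H)) \<in> spanning_trees Q" if "\<gamma> \<in> set_pmf \<mu>" for \<gamma>
  proof -
    have \<gamma>: "\<gamma> \<in> spanning_trees G" "\<gamma> \<inter> edges H \<in> spanning_trees H"
      using assms that by (auto simp: pmfs_on_def Gamma_star_def)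
    then have "(\<gamma> \<inter> edges H) \<union> (\<gamma> \<inter> (edges G - edges H)) = \<gamma>"
      by (auto simp: spanning_trees_def)
    then show "\<gamma> \<inter> edges H \<in> spanning_trees H"
      "\<phi> ` (\<gamma> \<inter> (edges G - edges H)) \<in> spanning_trees Q"
      using \<gamma> spanning_tree_contract[OF \<gamma>(2), of "\<gamma> \<inter> (edges G - edges H)"] by auto
  qed
  then show "marginal_core H \<mu> \<in> pmfs_on (spanning_trees H)"
    "marginal_shrunk G H \<phi> \<mu> \<in> pmfs_on (spanning_trees Q)"
    by (auto simp: pmfs_on_def marginal_core_def marginal_shrunk_def)
qed

text \<open>The overlap is a sum over edges, each edge is either in \<open>H\<close> or in the contracted graph, and the
  respective marginal preserves its probability.\<close>

lemma expected_overlap_split: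
  assumes "\<mu> \<in> pmfs_on (Gamma_star G H)"
  shows "expected_overlap (spanning_trees G) \<mu> =
    expected_overlap (spanning_trees H) (marginal_core H \<mu>) +
    expected_overlap (spanning_trees Q) (marginal_shrunk G H \<phi> \<mu>)"
proof -
  let ?p = "\<lambda>e. (edge_prob \<mu> e)\<^sup>2"
  have fin: "finite (edges G)" "finite (edges H)" "finite (edges Q)"
    using finite_edges multigraph_G multigraph_H multigraph_Q by blast+
  note trees = spanning_trees_subset_Pow
  have "\<mu> \<in> pmfs_on (spanning_trees G)"
    using assms by (auto simp: pmfs_on_def Gamma_star_def)
  then have "expected_overlap (spanning_trees G) \<mu> = (\<Sum>e\<in>edges G. ?p e)"
    by (rule expected_overlap_eq_sum_edge_prob[OF fin(1) trees])
  also have "\<dots> = (\<Sum>e\<in>edges H. ?p e) + (\<Sum>e\<in>edges G - edges H. ?p e)"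
    using sum.subset_diff[OF edges_H fin(1), of ?p] by simp
  also have "(\<Sum>e\<in>edges H. ?p e) = expected_overlap (spanning_trees H) (marginal_core H \<mu>)"
    using expected_overlap_eq_sum_edge_prob[OF fin(2) trees marginals_on_trees(1)[OF assms]]
    by (simp add: edge_prob_marginal_core)
  also have "(\<Sum>e\<in>edges G - edges H. ?p e) =
      expected_overlap (spanning_trees Q) (marginal_shrunk G H \<phi> \<mu>)"
    unfolding expected_overlap_eq_sum_edge_prob[OF fin(3) trees marginals_on_trees(2)[OF assms]]
    unfolding edges_Q sum.reindex[OF inj_\<phi>] by (simp add: edge_prob_marginal_shrunk)
  finally show ?thesis .
qed

abbreviation glue :: "'e set pmf \<Rightarrow> 'f set pmf \<Rightarrow> 'e set pmf" where
  "glue \<nu> \<kappa> \<equiv> direct_sum_pmf (edges G) (edges H) \<nu> (map_pmf (phi_inv G H \<phi>) \<kappa>)"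

text \<open>The direct sum is the law of the union of independent samples, a form in which marginals are
  easy to compute.\<close>

lemma direct_sum_pmf_eq_map_pair:
  assumes "\<nu>\<^sub>1 \<in> pmfs_on (Pow (edges H))" "\<nu>\<^sub>2 \<in> pmfs_on (Pow (edges G - edges H))"
  shows "direct_sum_pmf (edges G) (edges H) \<nu>\<^sub>1 \<nu>\<^sub>2 =
    map_pmf (\<lambda>(A, B). A \<union> B) (pair_pmf \<nu>\<^sub>1 \<nu>\<^sub>2)"
proof (rule pmf_eqI)
  fix S
  have "pmf (map_pmf (\<lambda>(A, B). A \<union> B) (pair_pmf \<nu>\<^sub>1 \<nu>\<^sub>2)) S =
      measure_pmf.prob (pair_pmf \<nu>\<^sub>1 \<nu>\<^sub>2)
        (if S \<subseteq> edges G then {(S \<inter> edges H, S - edges H)} else {})"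
    unfolding pmf_map
    by (rule measure_pmf.finite_measure_eq_AE)
      (use assms edges_H in \<open>fastforce simp: AE_measure_pmf_iff pmfs_on_def\<close>)+
  then show "pmf (direct_sum_pmf (edges G) (edges H) \<nu>\<^sub>1 \<nu>\<^sub>2) S =
      pmf (map_pmf (\<lambda>(A, B). A \<union> B) (pair_pmf \<nu>\<^sub>1 \<nu>\<^sub>2)) S"
    by (simp add: pmf_direct_sum_pmf[OF edges_H assms] measure_pmf_single pmf_pair)
qed

lemma glue_on_trees_and_marginals:
  assumes "\<nu> \<in> pmfs_on (spanning_trees H)" "\<kappa> \<in> pmfs_on (spanning_trees Q)"
  shows glue_on_Gamma_star: "glue \<nu> \<kappa> \<in> pmfs_on (Gamma_star G H)"
    and marginal_core_glue: "marginal_core H (glue \<nu> \<kappa>) = \<nu>"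
    and marginal_shrunk_glue: "marginal_shrunk G H \<phi> (glue \<nu> \<kappa>) = \<kappa>"
proof -
  define J where "J = (\<lambda>(A, C). A \<union> phi_inv G H \<phi> C)"
  have A: "A \<in> spanning_trees H" "A \<subseteq> edges H" if "A \<in> set_pmf \<nu>" for A
    using that assms(1) by (auto simp: pmfs_on_def spanning_trees_def)
  have C: "C \<in> spanning_trees Q" "C \<subseteq> edges Q" if "C \<in> set_pmf \<kappa>" for C
    using that assms(2) by (auto simp: pmfs_on_def spanning_trees_def)
  have "\<nu> \<in> pmfs_on (Pow (edges H))"
    using A(2) by (auto simp: pmfs_on_def)
  moreover have "map_pmf (phi_inv G H \<phi>) \<kappa> \<in> pmfs_on (Pow (edges G - edges H))"
    unfolding pmfs_on_def using phi_image_phi_inv(2)[OF C(2)] by (simp add: image_subset_iff)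
  ultimately have "glue \<nu> \<kappa> =
      map_pmf (\<lambda>(A, B). A \<union> B) (pair_pmf \<nu> (map_pmf (phi_inv G H \<phi>) \<kappa>))"
    by (rule direct_sum_pmf_eq_map_pair)
  also have "\<dots> = map_pmf J (pair_pmf \<nu> \<kappa>)"
    by (simp add: pair_map_pmf2 pmf.map_comp o_def J_def case_prod_unfold)
  finally have glue: "glue \<nu> \<kappa> = map_pmf J (pair_pmf \<nu> \<kappa>)" .
  have J: "J (A, C) \<inter> edges H = A" "\<phi> ` (J (A, C) \<inter> (edges G - edges H)) = C"
      "J (A, C) \<in> spanning_trees G" if "A \<in> set_pmf \<nu>" "C \<in> set_pmf \<kappa>" for A C
  proof -
    note AC = A[OF that(1)] C[OF that(2)]
    have inv: "\<phi> ` phi_inv G H \<phi> C = C" "phi_inv G H \<phi> C \<subseteq> edges G - edges H"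
      by (simp_all add: phi_image_phi_inv AC)
    show "J (A, C) \<inter> edges H = A"
      using AC(2) inv(2) by (auto simp: J_def)
    have "J (A, C) \<inter> (edges G - edges H) = phi_inv G H \<phi> C"
      using AC(2) inv(2) by (auto simp: J_def)
    then show "\<phi> ` (J (A, C) \<inter> (edges G - edges H)) = C"
      using inv(1) by simp
    show "J (A, C) \<in> spanning_trees G"
      using spanning_tree_contract[OF AC(1) inv(2)] inv(1) AC(3) by (simp add: J_def)
  qed
  show "glue \<nu> \<kappa> \<in> pmfs_on (Gamma_star G H)"
    unfolding glue using J A(1) by (auto simp: pmfs_on_def Gamma_star_def)
  have "marginal_core H (glue \<nu> \<kappa>) = map_pmf fst (pair_pmf \<nu> \<kappa>)"
    unfolding glue marginal_core_def pmf.map_comp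
    by (rule map_pmf_cong[OF refl]) (clarsimp simp: J(1))
  then show "marginal_core H (glue \<nu> \<kappa>) = \<nu>"
    by (simp add: map_fst_pair_pmf)
  have "marginal_shrunk G H \<phi> (glue \<nu> \<kappa>) = map_pmf snd (pair_pmf \<nu> \<kappa>)"
    unfolding glue marginal_shrunk_def pmf.map_comp
    by (rule map_pmf_cong[OF refl]) (clarsimp simp: J(2))
  then show "marginal_shrunk G H \<phi> (glue \<nu> \<kappa>) = \<kappa>"
    by (simp add: map_snd_pair_pmf)
qed

lemma expected_overlap_glue:
  assumes "\<nu> \<in> pmfs_on (spanning_trees H)" "\<kappa> \<in> pmfs_on (spanning_trees Q)"
  shows "expected_overlap (spanning_trees G) (glue \<nu> \<kappa>) =
    expected_overlap (spanning_trees H) \<nu> + expected_overlap (spanning_trees Q) \<kappa>"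
  using expected_overlap_split[OF glue_on_Gamma_star[OF assms]]
  by (simp add: marginal_core_glue[OF assms] marginal_shrunk_glue[OF assms])

text \<open>If one marginal could be improved, gluing the improvement to the other marginal would improve
  \<open>\<mu>\<close>.\<close>

lemma optimal_marginals:
  assumes "\<mu> \<in> pmfs_on (Gamma_star G H)" "optimal (spanning_trees G) \<mu>"
  shows "optimal (spanning_trees H) (marginal_core H \<mu>)"
    and "optimal (spanning_trees Q) (marginal_shrunk G H \<phi> \<mu>)"
proof -
  note marg = marginals_on_trees[OF assms(1)]
  have le: "expected_overlap (spanning_trees H) (marginal_core H \<mu>) +
      expected_overlap (spanning_trees Q) (marginal_shrunk G H \<phi> \<mu>)
    \<le> expected_overlap (spanning_trees H) \<nu> + expected_overlap (spanning_trees Q) \<kappa>"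
    if "\<nu> \<in> pmfs_on (spanning_trees H)" "\<kappa> \<in> pmfs_on (spanning_trees Q)" for \<nu> \<kappa>
  proof -
    have "glue \<nu> \<kappa> \<in> pmfs_on (spanning_trees G)"
      using glue_on_Gamma_star[OF that] by (auto simp: pmfs_on_def Gamma_star_def)
    then have "expected_overlap (spanning_trees G) \<mu> \<le> expected_overlap (spanning_trees G) (glue \<nu> \<kappa>)"
      using assms(2) by (simp add: optimal_def)
    then show ?thesis
      by (simp only: expected_overlap_split[OF assms(1)] expected_overlap_glue[OF that])
  qed
  show "optimal (spanning_trees H) (marginal_core H \<mu>)"
    using le[OF _ marg(2)] marg(1) by (simp add: optimal_def)
  show "optimal (spanning_trees Q) (marginal_shrunk G H \<phi> \<mu>)"
    using le[OF marg(1)] marg(2) by (simp add: optimal_def)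
qed

end

section \<open>Decomposition of optimal measures along a homogeneous core\<close>

theorem theorem5p7:
  fixes G H :: "('v, 'e) mgraph" and \<phi> :: "'e \<Rightarrow> 'f"
  assumes "multigraph G" and "connected_mgraph G" and "no_self_loops G"
    and "\<not> homogeneous G"
    and "homogeneous_core G H"
    and "inj_on \<phi> (edges G - edges H)"
  shows
    "MEO (spanning_trees G) =
       MEO (spanning_trees H) + MEO (spanning_trees (shrunk_graph G H \<phi>))
     \<and>
     (\<forall>\<mu> \<in> pmfs_on (spanning_trees G).
        optimal (spanning_trees G) \<mu> \<longleftrightarrow>
          \<mu> \<in> pmfs_on (Gamma_star G H) \<and>
          optimal (spanning_trees H) (marginal_core H \<mu>) \<and>
          optimal (spanning_trees (shrunk_graph G H \<phi>)) (marginal_shrunk G H \<phi> \<mu>))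
     \<and>
     (\<forall>\<mu>\<^sub>H \<mu>\<^sub>Q.
        optimal (spanning_trees H) \<mu>\<^sub>H \<and>
        optimal (spanning_trees (shrunk_graph G H \<phi>)) \<mu>\<^sub>Q \<longrightarrow>
          optimal (spanning_trees G)
            (direct_sum_pmf (edges G) (edges H) \<mu>\<^sub>H (map_pmf (phi_inv G H \<phi>) \<mu>\<^sub>Q)))
     \<and>
     (\<forall>\<mu> \<in> pmfs_on (Gamma_star G H).
        (\<forall>e \<in> edges H. edge_prob \<mu> e = edge_prob (marginal_core H \<mu>) e) \<and>
        (\<forall>e \<in> edges G - edges H.
           edge_prob \<mu> e = edge_prob (marginal_shrunk G H \<phi> \<mu>) (\<phi> e)))"
proof -
  interpret contraction G H \<phi>
    using assms(1,5,6) by unfold_locales (auto simp: homogeneous_core_def)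
  \<comment> \<open>The trees in the support of an optimal pmf are fair, so they restrict to trees of the core.\<close>
  have star: "\<mu> \<in> pmfs_on (Gamma_star G H)" if "optimal (spanning_trees G) \<mu>" for \<mu>
    unfolding pmfs_on_def
  proof safe
    fix \<gamma> assume "\<gamma> \<in> set_pmf \<mu>"
    then have "fair_tree G \<gamma>"
      using that by (auto simp: fair_tree_def optimal_def pmfs_on_def pmf_positive_iff)
    then show "\<gamma> \<in> Gamma_star G H"
      using assms(5) by (auto simp: Gamma_star_def homogeneous_core_def fair_tree_def)
  qed
  obtain \<mu>\<^sub>0 where opt0: "optimal (spanning_trees G) \<mu>\<^sub>0"
    using optimal_exists[OF finite_spanning_trees spanning_trees_nonempty] assms(1,2) by blast
  note star0 = star[OF opt0]
  have MEO: "MEO (spanning_trees G) = MEO (spanning_trees H) + MEO (spanning_trees Q)"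
    using expected_overlap_split[OF star0] optimal_MEO[OF opt0]
      optimal_MEO[OF optimal_marginals(1)[OF star0 opt0]]
      optimal_MEO[OF optimal_marginals(2)[OF star0 opt0]] by simp
  \<comment> \<open>With optimal marginals, the overlap of \<open>\<mu>\<close> is the sum of the two minima, which is the value at \<open>\<mu>\<^sub>0\<close>.\<close>
  have opt: "optimal (spanning_trees G) \<mu>"
    if "\<mu> \<in> pmfs_on (Gamma_star G H)" "optimal (spanning_trees H) (marginal_core H \<mu>)"
      "optimal (spanning_trees Q) (marginal_shrunk G H \<phi> \<mu>)" for \<mu>
  proof -
    have "expected_overlap (spanning_trees G) \<mu> = expected_overlap (spanning_trees G) \<mu>\<^sub>0"
      using expected_overlap_split[OF that(1)] MEO optimal_MEO[OF that(2)] optimal_MEO[OF that(3)]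
        optimal_MEO[OF opt0] by simp
    moreover have "\<mu> \<in> pmfs_on (spanning_trees G)"
      using that(1) by (auto simp: pmfs_on_def Gamma_star_def)
    ultimately show ?thesis
      using opt0 by (simp add: optimal_def)
  qed
  have glue: "optimal (spanning_trees G) (glue \<nu> \<kappa>)"
    if "optimal (spanning_trees H) \<nu>" "optimal (spanning_trees Q) \<kappa>" for \<nu> \<kappa>
  proof -
    have "\<nu> \<in> pmfs_on (spanning_trees H)" "\<kappa> \<in> pmfs_on (spanning_trees Q)"
      using that by (simp_all add: optimal_def)
    note glued = glue_on_trees_and_marginals[OF this]
    show ?thesis
      using opt[OF glued(1)] that by (simp add: glued(2,3))
  qed
  have iff: "optimal (spanning_trees G) \<mu> \<longleftrightarrow> \<mu> \<in> pmfs_on (Gamma_star G H) \<and>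
      optimal (spanning_trees H) (marginal_core H \<mu>) \<and>
      optimal (spanning_trees Q) (marginal_shrunk G H \<phi> \<mu>)" for \<mu>
    using star[of \<mu>] optimal_marginals[of \<mu>] opt[of \<mu>] by argo
  show ?thesis
    using MEO
    by (intro conjI ballI allI impI)
      (simp_all only: iff[symmetric] glue edge_prob_marginal_core edge_prob_marginal_shrunk)
qed

end
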